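(* Let $\mathcal{L}^{CA}_{free}$ denote the category of Lie conformal algebras that are free as $\mathbb{C}[\partial]$-modules, and $\mathcal{L}^{DC}_{free}$ the category of differential Lie coalgebras that are free as $\mathbb{C}[\partial]$-modules. The contravariant functor $(\ )^{0}:\mathcal{L}^{CA}_{free}\to\mathcal{L}^{DC}_{free}$ is right adjoint to the contravariant functor $(\ )^{*c}:\mathcal{L}^{DC}_{free}\to\mathcal{L}^{CA}_{free}$; i.e., for every Lie conformal algebra $L$ (in $\mathcal{L}^{CA}_{free}$) and every differential Lie coalgebra $M$ (in $\mathcal{L}^{DC}_{free}$), there is a natural set bijection $$\operatorname{Hom}_{\mathcal{L}^{CA}_{free}}(L,M^{*c})\;\simeq\;\operatorname{Hom}_{\mathcal{L}^{DC}_{free}}(M,L^{0}).$$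
   Context: A Lie conformal algebra $L$ is a left $\mathbb{C}[\partial]$-module with a $\mathbb{C}$-linear map $L\otimes L\to\mathbb{C}[\lambda]\otimes L$, $a\otimes b\mapsto[a_\lambda b]$, satisfying $[\partial a_\lambda b]=-\lambda[a_\lambda b]$, $[a_\lambda\partial b]=(\lambda+\partial)[a_\lambda b]$, $[a_\lambda b]=-[b_{-\lambda-\partial}\,a]$, and $[a_\lambda[b_\mu c]]=[[a_\lambda b]_{\lambda+\mu}c]+[b_\mu[a_\lambda c]]$. Homomorphisms are $\mathbb{C}[\partial]$-linear maps preserving $\lambda$-brackets. The conformal dual of a $\mathbb{C}[\partial]$-module $U$ is $U^{*c}=\{f:U\to\mathbb{C}[\lambda]\mid f\ \mathbb{C}\text{-linear},\ f_\lambda(\partial u)=\lambda f_\lambda(u)\}$, with $\mathbb{C}[\partial]$-action $(\partial f)_\lambda=-\lambda f_\lambda$. For a $\mathbb{C}[\partial]$-homomorphism $T:M\to N$, the transpose $T^*:N^{*c}\to M^{*c}$ is $[T^*(f)]_\lambda(m)=f_\lambda(T(m))$. Tensor products are over $\mathbb{C}$, with $\partial(u\otimes v)=\partial u\otimes v+u\otimes\partial v$. A differential Lie coalgebra $(C,\delta)$ is a $\mathbb{C}[\partial]$-module $C$ with a $\mathbb{C}[\partial]$-homomorphism $\delta:C\to C\otimes C$, $\delta(r)=\sum r_{(1)}\otimes r_{(2)}$, such that $\tau\delta=-\delta$ and $(I\otimes\delta)\delta-(\tau\otimes I)(I\otimes\delta)\delta=(\delta\otimes I)\delta$, where $\tau(a\otimes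 b)=b\otimes a$. A homomorphism $f:A\to B$ is a $\mathbb{C}[\partial]$-linear map with $\delta_B\circ f=(f\otimes f)\circ\delta_A$. The functor $(\ )^{*c}$ sends a differential Lie coalgebra $M$ to the Lie conformal algebra $M^{*c}$ with bracket $([f_\mu g])_\lambda(r)=\sum f_\mu(r_{(1)})\,g_{\lambda-\mu}(r_{(2)})$, and a morphism $T$ to $T^*$. The functor $(\ )^0$ is defined as follows. For a Lie conformal algebra $L$, define $\pi_\mu:L^{*c}\to\mathbb{C}[\mu]\otimes(L\otimes L)^{*c}$ by $[\pi_\mu(f)]_\lambda(a\otimes b)=f_\lambda([a_\mu b])$ and the injective map $\Phi_\mu:L^{*c}\otimes L^{*c}\to\mathbb{C}[\mu]\otimes(L\otimes L)^{*c}$ by $[\Phi_\mu(f\otimes g)]_\lambda(a\otimes b)=f_\mu(a)\,g_{\lambda-\mu}(b)$. A $\mathbb{C}[\partial]$-submodule $V\subseteq L^{*c}$ is good if $\pi_\mu(V)\subseteq\Phi_{-\mu}(V\otimes V)$; then $V$ is a differential Lie coalgebra with the unique $\delta_V:V\to V\otimes V$ such that $\Phi_{-\mu}(\delta_V(f))=\pi_\mu(f)$ for all $f\in V$. $L^0$ is the sum of all good $\mathbb{C}[\partial]$-submodules of $L^{*c}$; it is the largest good submodule, and it is a differential Lie coalgebra with $\delta_{L^0}$. For a homomorphism $F:L_1\to L_2$ of Lie conformal algebras, $F^*(L_2^0)\subseteq L_1^0$, and $F^0:L_2^0\to L_1^0$ is the restriction of $F^*$. These contravariant functors, defined between the categories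 of all Lie conformal algebras and all differential Lie coalgebras, are asserted in the source to restrict to the categories $\mathcal{L}^{CA}_{free}$ and $\mathcal{L}^{DC}_{free}$. *)

theory Defs
  imports
    Complex_Main
    "HOL-Computational_Algebra.Polynomial"
    "HOL-Library.Function_Algebras"
    "HOL-Library.Poly_Mapping"
begin

section \<open>Complex vector spaces\<close>

class complex_vector = ab_group_add +
  fixes scaleC :: "complex \<Rightarrow> 'a \<Rightarrow> 'a"  (infixr \<open>*\<^sub>C\<close> 75)
  assumes scaleC_add_right: "c *\<^sub>C (x + y) = c *\<^sub>C x + c *\<^sub>C y"
    and scaleC_add_left: "(c + d) *\<^sub>C x = c *\<^sub>C x + d *\<^sub>C x"
    and scaleC_scaleC: "c *\<^sub>C d *\<^sub>C x = (c * d) *\<^sub>C x"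
    and scaleC_one: "1 *\<^sub>C x = x"

global_interpretation complex_vector: vector_space "scaleC :: complex \<Rightarrow> 'a \<Rightarrow> 'a::complex_vector"
  by unfold_locales (simp_all add: scaleC_add_right scaleC_add_left scaleC_scaleC scaleC_one)

abbreviation cspan :: "'a::complex_vector set \<Rightarrow> 'a set"
  where "cspan \<equiv> complex_vector.span"

abbreviation csubspace :: "'a::complex_vector set \<Rightarrow> bool"
  where "csubspace \<equiv> complex_vector.subspace"

instantiation complex :: complex_vector
begin
definition scaleC_complex :: "complex \<Rightarrow> complex \<Rightarrow> complex" where "scaleC_complex = (*)"
instance by standard (simp_all add: scaleC_complex_def algebra_simps)
end

instantiation "fun" :: (type, complex_vector) complex_vector
begin
definition scaleC_fun :: "complex \<Rightarrow> ('a \<Rightarrow> 'b) \<Rightarrow> 'a \<Rightarrow> 'b"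
  where "scaleC_fun c f = (\<lambda>x. c *\<^sub>C f x)"
instance
  by standard (simp_all add: scaleC_fun_def fun_eq_iff scaleC_add_right scaleC_add_left
    scaleC_scaleC scaleC_one)
end

instantiation poly :: (complex_vector) complex_vector
begin
definition scaleC_poly :: "complex \<Rightarrow> 'a poly \<Rightarrow> 'a poly"
  where "scaleC_poly c p = map_poly (scaleC c) p"
instance
  by standard (simp_all add: scaleC_poly_def poly_eq_iff coeff_map_poly scaleC_add_right
    scaleC_add_left scaleC_scaleC scaleC_one)
end

instantiation poly_mapping :: (type, complex_vector) complex_vector
begin
definition scaleC_poly_mapping :: "complex \<Rightarrow> ('a \<Rightarrow>\<^sub>0 'b) \<Rightarrow> 'a \<Rightarrow>\<^sub>0 'b"
  where "scaleC_poly_mapping c p = Poly_Mapping.map (scaleC c) p"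

lemma lookup_scaleC: "Poly_Mapping.lookup (c *\<^sub>C p) k = c *\<^sub>C Poly_Mapping.lookup p k"
  for p :: "'a \<Rightarrow>\<^sub>0 'b"
  by (simp add: scaleC_poly_mapping_def Poly_Mapping.map.rep_eq when_def)

instance
  by standard (simp_all add: poly_mapping_eq_iff fun_eq_iff lookup_scaleC lookup_add
    scaleC_add_right scaleC_add_left scaleC_scaleC scaleC_one)
end

definition clinear_on :: "'a::complex_vector set \<Rightarrow> ('a \<Rightarrow> 'b::complex_vector) \<Rightarrow> bool"
  where "clinear_on V f \<longleftrightarrow>
    (\<forall>x\<in>V. \<forall>y\<in>V. f (x + y) = f x + f y) \<and> (\<forall>c. \<forall>x\<in>V. f (c *\<^sub>C x) = c *\<^sub>C f x)"

definition cbilinear_on ::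
    "'a::complex_vector set \<Rightarrow> 'b::complex_vector set \<Rightarrow> ('a \<Rightarrow> 'b \<Rightarrow> 'c::complex_vector) \<Rightarrow> bool"
  where "cbilinear_on V W \<beta> \<longleftrightarrow>
    (\<forall>y\<in>W. clinear_on V (\<lambda>x. \<beta> x y)) \<and> (\<forall>x\<in>V. clinear_on W (\<beta> x))"


section \<open>Tensor products over the complex numbers\<close>

text \<open>The type \<open>('a, 'b) tensor\<close> is the free vector space on \<open>'a \<times> 'b\<close> modulo the span of the
  bilinearity relations.\<close>

definition tensor_null :: "('a::complex_vector \<times> 'b::complex_vector \<Rightarrow>\<^sub>0 complex) set"
  where "tensor_null = cspan
    ({Poly_Mapping.single (x + x', y) 1 - Poly_Mapping.single (x, y) 1
        - Poly_Mapping.single (x', y) 1 | x x' y. True}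
   \<union> {Poly_Mapping.single (x, y + y') 1 - Poly_Mapping.single (x, y) 1
        - Poly_Mapping.single (x, y') 1 | x y y'. True}
   \<union> {Poly_Mapping.single (c *\<^sub>C x, y) 1 - Poly_Mapping.single (x, y) c | c x y. True}
   \<union> {Poly_Mapping.single (x, c *\<^sub>C y) 1 - Poly_Mapping.single (x, y) c | c x y. True})"

definition tensor_eq ::
    "('a::complex_vector \<times> 'b::complex_vector \<Rightarrow>\<^sub>0 complex) \<Rightarrow> ('a \<times> 'b \<Rightarrow>\<^sub>0 complex) \<Rightarrow> bool"
  where "tensor_eq p q \<longleftrightarrow> p - q \<in> tensor_null"

lemma subspace_tensor_null: "csubspace tensor_null"
  unfolding tensor_null_def by (rule complex_vector.subspace_span)

lemma tensor_eq_equivp: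
  "equivp (tensor_eq :: ('a::complex_vector \<times> 'b::complex_vector \<Rightarrow>\<^sub>0 complex) \<Rightarrow> _)"
proof (rule equivpI)
  show "reflp (tensor_eq :: ('a \<times> 'b \<Rightarrow>\<^sub>0 complex) \<Rightarrow> _)"
    by (auto simp: reflp_def tensor_eq_def complex_vector.subspace_0[OF subspace_tensor_null])
  show "symp (tensor_eq :: ('a \<times> 'b \<Rightarrow>\<^sub>0 complex) \<Rightarrow> _)"
  proof (rule sympI)
    fix p q :: "'a \<times> 'b \<Rightarrow>\<^sub>0 complex"
    assume "tensor_eq p q"
    then have "- (p - q) \<in> tensor_null"
      unfolding tensor_eq_def by (rule complex_vector.subspace_neg[OF subspace_tensor_null])
    then show "tensor_eq q p" by (simp add: tensor_eq_def)
  qed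
  show "transp (tensor_eq :: ('a \<times> 'b \<Rightarrow>\<^sub>0 complex) \<Rightarrow> _)"
  proof (rule transpI)
    fix p q r :: "'a \<times> 'b \<Rightarrow>\<^sub>0 complex"
    assume "tensor_eq p q" "tensor_eq q r"
    then have "(p - q) + (q - r) \<in> tensor_null"
      unfolding tensor_eq_def by (rule complex_vector.subspace_add[OF subspace_tensor_null])
    then show "tensor_eq p r" by (simp add: tensor_eq_def)
  qed
qed

quotient_type (overloaded) ('a, 'b) tensor = "('a::complex_vector \<times> 'b::complex_vector) \<Rightarrow>\<^sub>0 complex" / tensor_eq
  by (rule tensor_eq_equivp)

instantiation tensor :: (complex_vector, complex_vector) complex_vector
begin

lift_definition zero_tensor :: "('a, 'b) tensor" is 0 .

lift_definition plus_tensor :: "('a, 'b) tensor \<Rightarrow> ('a, 'b) tensor \<Rightarrow> ('a, 'b) tensor" is "(+)"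
  unfolding tensor_eq_def
proof -
  fix p p' q q' :: "'a \<times> 'b \<Rightarrow>\<^sub>0 complex"
  assume "p - p' \<in> tensor_null" "q - q' \<in> tensor_null"
  then have "(p - p') + (q - q') \<in> tensor_null"
    by (rule complex_vector.subspace_add[OF subspace_tensor_null])
  then show "p + q - (p' + q') \<in> tensor_null" by (simp add: algebra_simps)
qed

lift_definition uminus_tensor :: "('a, 'b) tensor \<Rightarrow> ('a, 'b) tensor" is uminus
  unfolding tensor_eq_def
proof -
  fix p p' :: "'a \<times> 'b \<Rightarrow>\<^sub>0 complex"
  assume "p - p' \<in> tensor_null"
  then have "- (p - p') \<in> tensor_null"
    by (rule complex_vector.subspace_neg[OF subspace_tensor_null])
  then show "- p - - p' \<in> tensor_null" by simp
qed

lift_definition minus_tensor :: "('a, 'b) tensor \<Rightarrow> ('a, 'b) tensor \<Rightarrow> ('a, 'b) tensor" is "(-)"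
  unfolding tensor_eq_def
proof -
  fix p p' q q' :: "'a \<times> 'b \<Rightarrow>\<^sub>0 complex"
  assume "p - p' \<in> tensor_null" "q - q' \<in> tensor_null"
  then have "(p - p') - (q - q') \<in> tensor_null"
    by (rule complex_vector.subspace_diff[OF subspace_tensor_null])
  then show "p - q - (p' - q') \<in> tensor_null" by (simp add: algebra_simps)
qed

lift_definition scaleC_tensor :: "complex \<Rightarrow> ('a, 'b) tensor \<Rightarrow> ('a, 'b) tensor" is scaleC
  unfolding tensor_eq_def
proof -
  fix c and p p' :: "'a \<times> 'b \<Rightarrow>\<^sub>0 complex"
  assume "p - p' \<in> tensor_null"
  then have "c *\<^sub>C (p - p') \<in> tensor_null"
    by (rule complex_vector.subspace_scale[OF subspace_tensor_null])
  then show "c *\<^sub>C p - c *\<^sub>C p' \<in> tensor_null"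
    by (simp add: complex_vector.scale_right_diff_distrib)
qed

instance
  by standard (transfer, simp add: tensor_eq_def algebra_simps scaleC_add_right scaleC_add_left
    scaleC_scaleC scaleC_one complex_vector.subspace_0[OF subspace_tensor_null])+

end

definition tensor_elem :: "'a::complex_vector \<Rightarrow> 'b::complex_vector \<Rightarrow> ('a, 'b) tensor"
    (infixr \<open>\<otimes>\<close> 76)
  where "x \<otimes> y = abs_tensor (Poly_Mapping.single (x, y) 1)"

text \<open>For subspaces \<open>V\<close> and \<open>W\<close>, the tensor product of \<open>V\<close> and \<open>W\<close> is identified with its
  (injective, as we are over a field) image in the tensor product of the ambient spaces.\<close>

definition tensor_sub ::
    "'a::complex_vector set \<Rightarrow> 'b::complex_vector set \<Rightarrow> ('a, 'b) tensor set"
  where "tensor_sub V W = cspan {x \<otimes> y | x y. x \<in> V \<and> y \<in> W}"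

definition formal_eval ::
    "('a \<Rightarrow> 'b \<Rightarrow> 'c::complex_vector) \<Rightarrow> ('a \<times> 'b \<Rightarrow>\<^sub>0 complex) \<Rightarrow> 'c"
  where "formal_eval \<beta> p =
    (\<Sum>(x, y)\<in>Poly_Mapping.keys p. Poly_Mapping.lookup p (x, y) *\<^sub>C \<beta> x y)"

text \<open>The linear map on the tensor product of \<open>V\<close> and \<open>W\<close> that is induced by a map \<open>\<beta>\<close> which is
  bilinear on \<open>V \<times> W\<close> (only). The value does not depend on the representative chosen, see
  \<open>tensor_lift_on_abs\<close> below; in particular it sends \<open>x \<otimes> y\<close> to \<open>\<beta> x y\<close>.\<close>

definition tensor_lift_on :: "'a::complex_vector set \<Rightarrow> 'b::complex_vector set \<Rightarrow>
    ('a \<Rightarrow> 'b \<Rightarrow> 'c::complex_vector) \<Rightarrow> ('a, 'b) tensor \<Rightarrow> 'c"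
  where "tensor_lift_on V W \<beta> t =
    formal_eval \<beta> (SOME p. Poly_Mapping.keys p \<subseteq> V \<times> W \<and> abs_tensor p = t)"

definition tensor_map_on :: "'a::complex_vector set \<Rightarrow> 'b::complex_vector set \<Rightarrow>
    ('a \<Rightarrow> 'c::complex_vector) \<Rightarrow> ('b \<Rightarrow> 'd::complex_vector) \<Rightarrow> ('a, 'b) tensor \<Rightarrow> ('c, 'd) tensor"
  where "tensor_map_on V W f g = tensor_lift_on V W (\<lambda>x y. f x \<otimes> g y)"

definition tensor_swap :: "('a::complex_vector, 'b::complex_vector) tensor \<Rightarrow> ('b, 'a) tensor"
  where "tensor_swap = tensor_lift_on UNIV UNIV (\<lambda>x y. y \<otimes> x)"

definition tensor_assoc ::
    "('a::complex_vector, ('b::complex_vector, 'c::complex_vector) tensor) tensor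
      \<Rightarrow> (('a, 'b) tensor, 'c) tensor"
  where "tensor_assoc = tensor_lift_on UNIV UNIV
    (\<lambda>x. tensor_lift_on UNIV UNIV (\<lambda>y z. (x \<otimes> y) \<otimes> z))"

subsection \<open>Induced maps are well defined\<close>

lemma formal_eval_superset:
  assumes "finite S" "Poly_Mapping.keys p \<subseteq> S"
  shows "formal_eval \<beta> p = (\<Sum>(x, y)\<in>S. Poly_Mapping.lookup p (x, y) *\<^sub>C \<beta> x y)"
  unfolding formal_eval_def
  by (rule sum.mono_neutral_left) (use assms in \<open>auto simp: in_keys_iff\<close>)

lemma formal_eval_add: "formal_eval \<beta> (p + q) = formal_eval \<beta> p + formal_eval \<beta> q"
proof -
  let ?S = "Poly_Mapping.keys p \<union> Poly_Mapping.keys q"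
  have "Poly_Mapping.keys (p + q) \<subseteq> ?S" by (rule Poly_Mapping.keys_add)
  then show ?thesis
    by (simp add: formal_eval_superset[of ?S] lookup_add case_prod_unfold scaleC_add_left
        sum.distrib)
qed

lemma formal_eval_scaleC: "formal_eval \<beta> (c *\<^sub>C p) = c *\<^sub>C formal_eval \<beta> p"
proof -
  have "Poly_Mapping.keys (c *\<^sub>C p) \<subseteq> Poly_Mapping.keys p"
    by (auto simp: in_keys_iff lookup_scaleC)
  then have "formal_eval \<beta> (c *\<^sub>C p) =
      (\<Sum>(x, y)\<in>Poly_Mapping.keys p. c *\<^sub>C Poly_Mapping.lookup p (x, y) *\<^sub>C \<beta> x y)"
    by (simp add: formal_eval_superset[of "Poly_Mapping.keys p"] lookup_scaleC scaleC_scaleC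
        scaleC_complex_def)
  then show ?thesis
    by (simp add: formal_eval_def case_prod_unfold complex_vector.scale_sum_right)
qed

lemma formal_eval_diff: "formal_eval \<beta> (p - q) = formal_eval \<beta> p - formal_eval \<beta> q"
  using formal_eval_add[of \<beta> "p - q" q] by simp

lemma formal_eval_single: "formal_eval \<beta> (Poly_Mapping.single (x, y) c) = c *\<^sub>C \<beta> x y"
  by (simp add: formal_eval_superset[of "{(x, y)}"])

lemma formal_eval_null:
  assumes "cbilinear_on UNIV UNIV \<beta>" "p \<in> tensor_null"
  shows "formal_eval \<beta> p = 0"
  using assms(2) unfolding tensor_null_def
proof (induction rule: complex_vector.span_induct_alt)
  case base
  show ?case by (simp add: formal_eval_def)
next
  case (step c x y)
  have "formal_eval \<beta> x = 0"
    using step(1) assms(1)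
    by (auto simp: formal_eval_diff formal_eval_single cbilinear_on_def clinear_on_def scaleC_one)
  with step show ?case by (simp add: formal_eval_add formal_eval_scaleC)
qed

lemma csubspace_projection:
  fixes V :: "'a::complex_vector set"
  assumes "csubspace V"
  obtains P where "clinear_on UNIV P" "\<And>x. P x \<in> V" "\<And>x. x \<in> V \<Longrightarrow> P x = x"
proof -
  interpret vector_space_pair "scaleC :: complex \<Rightarrow> 'a \<Rightarrow> 'a" "scaleC :: complex \<Rightarrow> 'a \<Rightarrow> 'a" ..
  obtain P where "P ` UNIV \<subseteq> V" "Vector_Spaces.linear scaleC scaleC P" "\<forall>v\<in>V. P (id v) = v"
    using linear_exists_left_inverse_on[OF complex_vector.linear_id assms] by auto
  then show thesis
    by (intro that[of P])
      (auto simp: clinear_on_def Vector_Spaces.linear.axioms linear_add linear_scale)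
qed

lemma tensor_lift_on_abs:
  assumes "csubspace V" "csubspace W" "cbilinear_on V W \<beta>" "Poly_Mapping.keys p \<subseteq> V \<times> W"
  shows "tensor_lift_on V W \<beta> (abs_tensor p) = formal_eval \<beta> p"
proof -
  obtain P where P: "clinear_on UNIV P" "\<And>x. P x \<in> V" "\<And>x. x \<in> V \<Longrightarrow> P x = x"
    using csubspace_projection[OF assms(1)] by blast
  obtain Q where Q: "clinear_on UNIV Q" "\<And>x. Q x \<in> W" "\<And>x. x \<in> W \<Longrightarrow> Q x = x"
    using csubspace_projection[OF assms(2)] by blast
  define \<gamma> where "\<gamma> = (\<lambda>x y. \<beta> (P x) (Q y))"
  have \<gamma>: "cbilinear_on UNIV UNIV \<gamma>"
    using assms(3) P Q by (auto simp: \<gamma>_def cbilinear_on_def clinear_on_def)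
  have eq: "formal_eval \<gamma> q = formal_eval \<beta> q" if "Poly_Mapping.keys q \<subseteq> V \<times> W" for q
    unfolding formal_eval_def using that by (intro sum.cong) (auto simp: \<gamma>_def P Q)
  define q where "q = (SOME q. Poly_Mapping.keys q \<subseteq> V \<times> W \<and> abs_tensor q = abs_tensor p)"
  have q: "Poly_Mapping.keys q \<subseteq> V \<times> W \<and> abs_tensor q = abs_tensor p"
    unfolding q_def by (rule someI) (use assms(4) in simp)
  then have "tensor_eq q p" by (simp add: tensor.abs_eq_iff)
  then have "formal_eval \<gamma> (q - p) = 0"
    unfolding tensor_eq_def by (rule formal_eval_null[OF \<gamma>])
  then show ?thesis
    using eq q assms(4) by (simp add: tensor_lift_on_def q_def[symmetric] formal_eval_diff)
qed

lemma tensor_lift_on_elem: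
  assumes "csubspace V" "csubspace W" "cbilinear_on V W \<beta>" "x \<in> V" "y \<in> W"
  shows "tensor_lift_on V W \<beta> (x \<otimes> y) = \<beta> x y"
  unfolding tensor_elem_def
  by (subst tensor_lift_on_abs) (use assms in \<open>auto simp: formal_eval_single scaleC_one\<close>)


section \<open>Modules over the polynomial ring in one derivation\<close>

text \<open>A module over the ring of complex polynomials in \<open>\<partial>\<close> is a complex vector space, given as a
  subspace of an ambient type, with a linear endomorphism. Outside the carrier the operations are
  arbitrary.\<close>

record 'a cdmod =
  carrier :: "'a set"
  del :: "'a \<Rightarrow> 'a"

definition is_cdmod :: "('a::complex_vector, 'x) cdmod_scheme \<Rightarrow> bool"
  where "is_cdmod M \<longleftrightarrow> csubspace (carrier M) \<and>
    (\<forall>x\<in>carrier M. del M x \<in> carrier M) \<and> clinear_on (carrier M) (del M)"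

definition poly_act ::
    "('a::complex_vector, 'x) cdmod_scheme \<Rightarrow> complex poly \<Rightarrow> 'a \<Rightarrow> 'a"
  where "poly_act M p x = (\<Sum>i\<le>degree p. coeff p i *\<^sub>C (del M ^^ i) x)"

definition is_free :: "('a::complex_vector, 'x) cdmod_scheme \<Rightarrow> bool"
  where "is_free M \<longleftrightarrow> (\<exists>B\<subseteq>carrier M. \<forall>x\<in>carrier M. \<exists>!c :: 'a \<Rightarrow> complex poly.
    finite {b. c b \<noteq> 0} \<and> {b. c b \<noteq> 0} \<subseteq> B \<and> x = (\<Sum>b | c b \<noteq> 0. poly_act M (c b) b))"

text \<open>Maps between carriers are represented by functions that vanish outside the carrier, so that
  equality of functions is equality of morphisms and composition is \<open>(\<circ>)\<close>.\<close>

definition restrict_zero :: "'a set \<Rightarrow> ('a \<Rightarrow> 'b::zero) \<Rightarrow> 'a \<Rightarrow> 'b"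
  where "restrict_zero A f = (\<lambda>x. if x \<in> A then f x else 0)"

definition cdmod_hom :: "('a::complex_vector, 'x) cdmod_scheme \<Rightarrow>
    ('b::complex_vector, 'y) cdmod_scheme \<Rightarrow> ('a \<Rightarrow> 'b) set"
  where "cdmod_hom M N = {f. (\<forall>x\<in>carrier M. f x \<in> carrier N) \<and> clinear_on (carrier M) f \<and>
    (\<forall>x\<in>carrier M. f (del M x) = del N (f x)) \<and> (\<forall>x. x \<notin> carrier M \<longrightarrow> f x = 0)}"

text \<open>The conformal dual. The value \<open>f u\<close> is a polynomial in \<open>\<lambda>\<close>, so \<open>[:0, 1:]\<close> is \<open>\<lambda>\<close>.\<close>

definition conf_dual :: "('a::complex_vector, 'x) cdmod_scheme \<Rightarrow> ('a \<Rightarrow> complex poly) set"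
  where "conf_dual U = {f. clinear_on (carrier U) f \<and>
    (\<forall>u\<in>carrier U. f (del U u) = [:0, 1:] * f u) \<and> (\<forall>u. u \<notin> carrier U \<longrightarrow> f u = 0)}"

definition conf_dual_del :: "('a \<Rightarrow> complex poly) \<Rightarrow> 'a \<Rightarrow> complex poly"
  where "conf_dual_del f = (\<lambda>u. - [:0, 1:] * f u)"

definition transpose :: "('a \<Rightarrow> 'b) \<Rightarrow> ('b \<Rightarrow> complex poly) \<Rightarrow> 'a \<Rightarrow> complex poly"
  where "transpose T f = (\<lambda>m. f (T m))"


section \<open>Lie conformal algebras\<close>

text \<open>\<open>bracket L a b n\<close> is the coefficient of \<open>\<lambda>\<^sup>n\<close> in \<open>[a\<^sub>\<lambda> b]\<close>; that the bracket is polynomial in \<open>\<lambda>\<close> is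
  the finiteness condition in \<open>lie_conformal_algebra\<close>.\<close>

record 'a lca = "'a cdmod" +
  bracket :: "'a \<Rightarrow> 'a \<Rightarrow> nat \<Rightarrow> 'a"

text \<open>The last four conditions are the four axioms, compared coefficientwise: at \<open>\<lambda>\<^sup>n\<close> for
  sesquilinearity; at \<open>\<lambda>\<^sup>n\<close> for skew-symmetry, where
  \<open>(- \<lambda> - \<partial>)\<^sup>k = (- 1)\<^sup>k (\<Sum>n\<le>k. (k choose n) \<lambda>\<^sup>n \<partial>\<^sup>k\<^sup>-\<^sup>n)\<close>; and at \<open>\<lambda>\<^sup>m \<mu>\<^sup>n\<close> for the Jacobi identity,
  where \<open>\<lambda>\<^sup>k (\<lambda> + \<mu>)\<^sup>j\<close> contributes for \<open>k \<le> m\<close> and \<open>j = m - k + n\<close>.\<close>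

definition lie_conformal_algebra :: "('a::complex_vector) lca \<Rightarrow> bool"
  where "lie_conformal_algebra L \<longleftrightarrow> is_cdmod L \<and>
    (\<forall>a\<in>carrier L. \<forall>b\<in>carrier L. \<forall>n. bracket L a b n \<in> carrier L) \<and>
    (\<forall>a\<in>carrier L. \<forall>b\<in>carrier L. finite {n. bracket L a b n \<noteq> 0}) \<and>
    (\<forall>n. cbilinear_on (carrier L) (carrier L) (\<lambda>a b. bracket L a b n)) \<and>
    (\<forall>a\<in>carrier L. \<forall>b\<in>carrier L. \<forall>n.
      bracket L (del L a) b n = (if n = 0 then 0 else - bracket L a b (n - 1))) \<and>
    (\<forall>a\<in>carrier L. \<forall>b\<in>carrier L. \<forall>n.
      bracket L a (del L b) n
        = (if n = 0 then 0 else bracket L a b (n - 1)) + del L (bracket L a b n)) \<and>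
    (\<forall>a\<in>carrier L. \<forall>b\<in>carrier L. \<forall>n.
      bracket L a b n = - (\<Sum>k | bracket L b a k \<noteq> 0.
        ((- 1) ^ k * of_nat (k choose n)) *\<^sub>C (del L ^^ (k - n)) (bracket L b a k))) \<and>
    (\<forall>a\<in>carrier L. \<forall>b\<in>carrier L. \<forall>c\<in>carrier L. \<forall>m n.
      bracket L a (bracket L b c n) m
        = (\<Sum>k\<le>m. of_nat ((m - k + n) choose n) *\<^sub>C bracket L (bracket L a b k) c (m - k + n))
          + bracket L b (bracket L a c m) n)"

definition lca_hom :: "('a::complex_vector) lca \<Rightarrow> ('b::complex_vector) lca \<Rightarrow> ('a \<Rightarrow> 'b) set"
  where "lca_hom L L' = {f \<in> cdmod_hom L L'. \<forall>a\<in>carrier L. \<forall>b\<in>carrier L. \<forall>n.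
    f (bracket L a b n) = bracket L' (f a) (f b) n}"

definition LCA_free :: "('a::complex_vector) lca set"
  where "LCA_free = {L. lie_conformal_algebra L \<and> is_free L}"


section \<open>Differential Lie coalgebras\<close>

record (overloaded) ('a::complex_vector) dlc = "'a cdmod" +
  cobracket :: "'a \<Rightarrow> ('a, 'a) tensor"

text \<open>The identity for the iterated cobracket is stated in \<open>(C \<otimes> C) \<otimes> C\<close>, using the associativity
  isomorphism.\<close>

definition differential_lie_coalgebra :: "('a::complex_vector) dlc \<Rightarrow> bool"
  where "differential_lie_coalgebra C \<longleftrightarrow> is_cdmod C \<and>
    (let V = carrier C; \<delta> = cobracket C; VV = tensor_sub V V;
         I\<delta> = tensor_map_on V V id \<delta>; \<delta>I = tensor_map_on V V \<delta> id;
         \<tau>I = tensor_map_on VV V tensor_swap id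
     in clinear_on V \<delta> \<and> (\<forall>r\<in>V. \<delta> r \<in> VV) \<and>
        (\<forall>r\<in>V. \<delta> (del C r)
          = tensor_map_on V V (del C) id (\<delta> r) + tensor_map_on V V id (del C) (\<delta> r)) \<and>
        (\<forall>r\<in>V. tensor_swap (\<delta> r) = - \<delta> r) \<and>
        (\<forall>r\<in>V. tensor_assoc (I\<delta> (\<delta> r)) - \<tau>I (tensor_assoc (I\<delta> (\<delta> r))) = \<delta>I (\<delta> r)))"

definition dlc_hom :: "('a::complex_vector) dlc \<Rightarrow> ('b::complex_vector) dlc \<Rightarrow> ('a \<Rightarrow> 'b) set"
  where "dlc_hom A B = {f \<in> cdmod_hom A B. \<forall>r\<in>carrier A.
    cobracket B (f r) = tensor_map_on (carrier A) (carrier A) f f (cobracket A r)}"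

definition DLC_free :: "('a::complex_vector) dlc set"
  where "DLC_free = {C. differential_lie_coalgebra C \<and> is_free C}"


section \<open>Polynomials in two indeterminates\<close>

text \<open>Elements of \<open>complex poly poly\<close> are polynomials in \<open>\<mu>\<close> whose coefficients are polynomials in
  \<open>\<lambda>\<close>; \<open>eval_at p q\<close> substitutes \<open>q\<close> for the indeterminate of \<open>p\<close>.\<close>

definition Lam :: "complex poly poly" where "Lam = [:[:0, 1:]:]"
definition Mu :: "complex poly poly" where "Mu = [:0, 1:]"

definition eval_at :: "complex poly \<Rightarrow> complex poly poly \<Rightarrow> complex poly poly"
  where "eval_at p q = pcompose (map_poly (\<lambda>c. [:c:]) p) q"


section \<open>The functor to Lie conformal algebras\<close>

text \<open>\<open>([f\<^sub>\<mu> g])\<^sub>\<lambda> (r)\<close> as a polynomial in \<open>\<lambda>\<close> and \<open>\<mu>\<close>. For modules of infinite rank its degree in \<open>\<mu>\<close>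
  need not be bounded as \<open>r\<close> varies. The sequence of its coefficients is always defined, and it is
  finite for all \<open>f\<close> and \<open>g\<close> exactly if the bracket is polynomial. Likewise the dual of a free module of
  infinite rank need not be free. As \<open>lca_hom\<close> only refers to the structure maps of its arguments,
  the homomorphisms into \<open>dual_lca M\<close> make sense in all cases.\<close>

definition dual_bracket_poly :: "('a::complex_vector) dlc \<Rightarrow> ('a \<Rightarrow> complex poly) \<Rightarrow>
    ('a \<Rightarrow> complex poly) \<Rightarrow> 'a \<Rightarrow> complex poly poly"
  where "dual_bracket_poly M f g r = tensor_lift_on (carrier M) (carrier M)
    (\<lambda>x y. eval_at (f x) Mu * eval_at (g y) (Lam - Mu)) (cobracket M r)"

definition dual_lca :: "('a::complex_vector) dlc \<Rightarrow> ('a \<Rightarrow> complex poly) lca"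
  where "dual_lca M = \<lparr>carrier = conf_dual M, del = conf_dual_del,
    bracket = (\<lambda>f g n. restrict_zero (carrier M) (\<lambda>r. coeff (dual_bracket_poly M f g r) n))\<rparr>"

definition dual_lca_map :: "('a::complex_vector) dlc \<Rightarrow> ('b::complex_vector) dlc \<Rightarrow>
    ('a \<Rightarrow> 'b) \<Rightarrow> ('b \<Rightarrow> complex poly) \<Rightarrow> 'a \<Rightarrow> complex poly"
  where "dual_lca_map M N T = restrict_zero (carrier (dual_lca N)) (transpose T)"


section \<open>The functor to differential Lie coalgebras\<close>

text \<open>\<open>\<pi>\<^sub>\<mu> f\<close> and \<open>\<Phi>\<^sub>\<nu> t\<close> are represented by their values, polynomials in \<open>\<lambda>\<close> and \<open>\<mu>\<close>, on \<open>a \<otimes> b\<close> for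
  \<open>a\<close> and \<open>b\<close> in the algebra. The parameter \<open>\<nu>\<close> is \<open>\<mu>\<close> or \<open>- \<mu>\<close>. Again, the
  degree in \<open>\<mu>\<close> need not be bounded as \<open>a\<close> and \<open>b\<close> vary.\<close>

definition pi_map ::
    "('a::complex_vector) lca \<Rightarrow> ('a \<Rightarrow> complex poly) \<Rightarrow> 'a \<Rightarrow> 'a \<Rightarrow> complex poly poly"
  where "pi_map L f a b = (\<Sum>n | bracket L a b n \<noteq> 0. monom (f (bracket L a b n)) n)"

definition Phi_map :: "complex poly poly \<Rightarrow>
    ('a \<Rightarrow> complex poly, 'a \<Rightarrow> complex poly) tensor \<Rightarrow> 'a \<Rightarrow> 'a \<Rightarrow> complex poly poly"
  where "Phi_map \<nu> t a b =
    tensor_lift_on UNIV UNIV (\<lambda>f g. eval_at (f a) \<nu> * eval_at (g b) (Lam - \<nu>)) t"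

definition is_cobracket_of :: "('a::complex_vector) lca \<Rightarrow> ('a \<Rightarrow> complex poly) set \<Rightarrow>
    ('a \<Rightarrow> complex poly) \<Rightarrow> ('a \<Rightarrow> complex poly, 'a \<Rightarrow> complex poly) tensor \<Rightarrow> bool"
  where "is_cobracket_of L V f t \<longleftrightarrow> t \<in> tensor_sub V V \<and>
    (\<forall>a\<in>carrier L. \<forall>b\<in>carrier L. Phi_map (- Mu) t a b = pi_map L f a b)"

definition good :: "('a::complex_vector) lca \<Rightarrow> ('a \<Rightarrow> complex poly) set \<Rightarrow> bool"
  where "good L V \<longleftrightarrow> V \<subseteq> conf_dual L \<and> csubspace V \<and> (\<forall>f\<in>V. conf_dual_del f \<in> V) \<and>
    (\<forall>f\<in>V. \<exists>t. is_cobracket_of L V f t)"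

definition good_sum :: "('a::complex_vector) lca \<Rightarrow> ('a \<Rightarrow> complex poly) set"
  where "good_sum L = cspan (\<Union>{V. good L V})"

definition zero_dlc :: "('a::complex_vector) lca \<Rightarrow> ('a \<Rightarrow> complex poly) dlc"
  where "zero_dlc L = \<lparr>carrier = good_sum L, del = conf_dual_del,
    cobracket = (\<lambda>f. THE t. is_cobracket_of L (good_sum L) f t)\<rparr>"

definition zero_dlc_map :: "('a::complex_vector) lca \<Rightarrow> ('b::complex_vector) lca \<Rightarrow>
    ('a \<Rightarrow> 'b) \<Rightarrow> ('b \<Rightarrow> complex poly) \<Rightarrow> 'a \<Rightarrow> complex poly"
  where "zero_dlc_map L L' F = restrict_zero (carrier (zero_dlc L')) (transpose F)"

end

theory Submission
  imports Defs
begin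

text \<open>A homomorphism \<open>\<phi>\<close> from \<open>L\<close> into the conformal dual of \<open>M\<close> and a homomorphism \<open>\<psi>\<close> from \<open>M\<close> into
  the conformal dual of \<open>L\<close> are the same pairing, read with opposite signs of \<open>\<lambda>\<close>:
  \<open>\<psi>(m)\<^sub>\<lambda>(a) = \<phi>(a)\<^sub>-\<^sub>\<lambda>(m)\<close>. Under this involution \<open>\<phi>\<close> preserves brackets if and only if
  \<open>\<pi>\<^sub>\<mu>(\<psi>(r)) = \<Phi>\<^sub>-\<^sub>\<mu>((\<psi> \<otimes> \<psi>)(\<delta>(r)))\<close> for all \<open>r\<close>. In that case the image of \<open>\<psi>\<close> is good, so \<open>\<psi>\<close> maps
  into \<open>L\<^sup>0\<close>, and injectivity of \<open>\<Phi>\<close> turns the identity into compatibility with the cobrackets.\<close>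

section \<open>Tensor products\<close>

lemma clinear_onD:
  assumes "clinear_on V f" "x \<in> V"
  shows clinear_on_add: "y \<in> V \<Longrightarrow> f (x + y) = f x + f y"
    and clinear_on_scale: "f (c *\<^sub>C x) = c *\<^sub>C f x"
  using assms by (auto simp: clinear_on_def)

lemma clinear_on_zero:
  assumes "clinear_on V f" "csubspace V"
  shows "f 0 = 0"
  using clinear_on_scale[OF assms(1) complex_vector.subspace_0[OF assms(2)], of 0] by simp

lemma clinear_on_sum:
  assumes "clinear_on UNIV h"
  shows "h (sum f S) = (\<Sum>i\<in>S. h (f i))"
proof (induction S rule: infinite_finite_induct)
  case (insert x F)
  then show ?case by (simp add: clinear_on_add[OF assms])
qed (simp_all add: clinear_on_zero[OF assms])

lemma clinear_on_formal_eval: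
  assumes "clinear_on UNIV h"
  shows "h (formal_eval \<beta> p) = formal_eval (\<lambda>x y. h (\<beta> x y)) p"
  by (simp add: formal_eval_def clinear_on_sum[OF assms] clinear_on_scale[OF assms] case_prod_unfold)

lemma scaleC_single: "c *\<^sub>C Poly_Mapping.single k d = Poly_Mapping.single k (c * d)"
  by (rule poly_mapping_eqI) (simp add: lookup_scaleC lookup_single when_def scaleC_complex_def)

section \<open>Bilinearity of the tensor symbol\<close>

lemma abs_tensor_add: "abs_tensor (p + q) = abs_tensor p + abs_tensor q"
  by (simp add: plus_tensor.abs_eq)

lemma abs_tensor_scaleC: "abs_tensor (c *\<^sub>C p) = c *\<^sub>C abs_tensor p"
  by (simp add: scaleC_tensor.abs_eq)

lemma clinear_on_abs_tensor: "clinear_on UNIV abs_tensor"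
  by (simp add: clinear_on_def abs_tensor_add abs_tensor_scaleC)

lemma abs_tensor_eqI: "p - q \<in> tensor_null \<Longrightarrow> abs_tensor p = abs_tensor q"
  by (simp add: tensor.abs_eq_iff tensor_eq_def)

lemma tensor_elem_add_left: "(x + x') \<otimes> y = x \<otimes> y + x' \<otimes> y"
  unfolding tensor_elem_def abs_tensor_add[symmetric]
  by (rule abs_tensor_eqI, unfold tensor_null_def, rule complex_vector.span_base)
    (force simp: diff_diff_eq)

lemma tensor_elem_add_right: "x \<otimes> (y + y') = x \<otimes> y + x \<otimes> y'"
  unfolding tensor_elem_def abs_tensor_add[symmetric]
  by (rule abs_tensor_eqI, unfold tensor_null_def, rule complex_vector.span_base)
    (force simp: diff_diff_eq)

lemma tensor_elem_scaleC_left: "(c *\<^sub>C x) \<otimes> y = c *\<^sub>C (x \<otimes> y)"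
  unfolding tensor_elem_def abs_tensor_scaleC[symmetric] scaleC_single
  by (rule abs_tensor_eqI, unfold tensor_null_def, rule complex_vector.span_base) auto

lemma tensor_elem_scaleC_right: "x \<otimes> (c *\<^sub>C y) = c *\<^sub>C (x \<otimes> y)"
  unfolding tensor_elem_def abs_tensor_scaleC[symmetric] scaleC_single
  by (rule abs_tensor_eqI, unfold tensor_null_def, rule complex_vector.span_base, rule UnI2) auto

lemma tensor_elem_zero_left [simp]: "0 \<otimes> y = 0"
  using tensor_elem_scaleC_left[of 0 0 y] by simp

lemma tensor_elem_zero_right [simp]: "x \<otimes> 0 = 0"
  using tensor_elem_scaleC_right[of x 0 0] by simp

lemmas tensor_elem_bilinear =
  tensor_elem_add_left tensor_elem_add_right tensor_elem_scaleC_left tensor_elem_scaleC_right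

text \<open>A formal sum is its own expansion into generators; the linear map
  \<open>abs_tensor\<close> carries this expansion to the quotient.\<close>

lemma abs_tensor_eq_formal_eval: "abs_tensor p = formal_eval (\<otimes>) p"
proof -
  have "formal_eval (\<lambda>x y. Poly_Mapping.single (x, y) 1) p = p"
    by (rule poly_mapping_eqI)
      (auto simp: formal_eval_def case_prod_unfold scaleC_single lookup_sum lookup_single when_def
        in_keys_iff)
  then show ?thesis
    using clinear_on_formal_eval[OF clinear_on_abs_tensor,
        of "\<lambda>x y. Poly_Mapping.single (x, y) 1" p]
    by (simp add: tensor_elem_def[abs_def])
qed

section \<open>Tensor products of subspaces and induced maps\<close>

lemma subspace_tensor_sub: "csubspace (tensor_sub V W)"
  unfolding tensor_sub_def by (rule complex_vector.subspace_span)

lemma tensor_sub_mono: "V \<subseteq> V' \<Longrightarrow> W \<subseteq> W' \<Longrightarrow> tensor_sub V W \<subseteq> tensor_sub V' W'"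
  unfolding tensor_sub_def by (rule complex_vector.span_mono) blast

lemma tensor_sub_elem: "x \<in> V \<Longrightarrow> y \<in> W \<Longrightarrow> x \<otimes> y \<in> tensor_sub V W"
  unfolding tensor_sub_def by (rule complex_vector.span_base) blast

text \<open>\<open>tensor_lift_on_abs\<close> evaluates an induced map only on representatives with
  keys in \<open>V \<times> W\<close>; this supplies one.\<close>

lemma tensor_subE:
  assumes "t \<in> tensor_sub V W"
  obtains p where "Poly_Mapping.keys p \<subseteq> V \<times> W" "t = abs_tensor p"
proof -
  have "\<exists>p. Poly_Mapping.keys p \<subseteq> V \<times> W \<and> t = abs_tensor p"
    using assms unfolding tensor_sub_def
  proof (induction rule: complex_vector.span_induct_alt)
    case base
    show ?case by (rule exI[of _ 0]) (simp add: zero_tensor.abs_eq)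
  next
    case (step c s t)
    from step(1) obtain x y where xy: "s = x \<otimes> y" "x \<in> V" "y \<in> W" by blast
    from step(2) obtain p where p: "Poly_Mapping.keys p \<subseteq> V \<times> W" "t = abs_tensor p" by blast
    have "Poly_Mapping.keys (Poly_Mapping.single (x, y) c + p) \<subseteq> V \<times> W"
      using Poly_Mapping.keys_add[of "Poly_Mapping.single (x, y) c" p] p xy
      by (auto split: if_splits)
    moreover have "c *\<^sub>C s + t = abs_tensor (Poly_Mapping.single (x, y) c + p)"
      by (simp add: xy p abs_tensor_add tensor_elem_def abs_tensor_scaleC[symmetric] scaleC_single)
    ultimately show ?case by blast
  qed
  then show thesis using that by blast
qed

lemma formal_eval_in_subspace:
  assumes "csubspace U" "\<And>x y. (x, y) \<in> Poly_Mapping.keys p \<Longrightarrow> \<beta> x y \<in> U"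
  shows "formal_eval \<beta> p \<in> U"
  unfolding formal_eval_def
  by (rule complex_vector.subspace_sum[OF assms(1)])
    (use assms in \<open>auto intro!: complex_vector.subspace_scale\<close>)

lemma tensor_lift_abs:
  assumes "cbilinear_on UNIV UNIV \<beta>"
  shows "tensor_lift_on UNIV UNIV \<beta> (abs_tensor p) = formal_eval \<beta> p"
  by (rule tensor_lift_on_abs) (simp_all add: assms)

lemma clinear_on_tensor_lift:
  fixes \<beta> :: "'a::complex_vector \<Rightarrow> 'b::complex_vector \<Rightarrow> 'c::complex_vector"
  assumes "cbilinear_on UNIV UNIV \<beta>"
  shows "clinear_on UNIV (tensor_lift_on UNIV UNIV \<beta>)"
  unfolding clinear_on_def
proof (intro conjI ballI allI)
  fix s t :: "('a, 'b) tensor" and c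
  obtain p where p: "s = abs_tensor p" by (metis Quotient_abs_rep Quotient_tensor)
  obtain q where q: "t = abs_tensor q" by (metis Quotient_abs_rep Quotient_tensor)
  show "tensor_lift_on UNIV UNIV \<beta> (s + t)
      = tensor_lift_on UNIV UNIV \<beta> s + tensor_lift_on UNIV UNIV \<beta> t"
    by (simp add: p q abs_tensor_add[symmetric] tensor_lift_abs[OF assms] formal_eval_add)
  show "tensor_lift_on UNIV UNIV \<beta> (c *\<^sub>C s) = c *\<^sub>C tensor_lift_on UNIV UNIV \<beta> s"
    by (simp add: p abs_tensor_scaleC[symmetric] tensor_lift_abs[OF assms] formal_eval_scaleC)
qed

lemma tensor_map_on_abs:
  assumes "csubspace V" "csubspace W" "clinear_on V f" "clinear_on W g"
    "Poly_Mapping.keys p \<subseteq> V \<times> W"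
  shows "tensor_map_on V W f g (abs_tensor p) = formal_eval (\<lambda>x y. f x \<otimes> g y) p"
proof -
  have "cbilinear_on V W (\<lambda>x y. f x \<otimes> g y)"
    using assms(3,4) by (auto simp: cbilinear_on_def clinear_on_def tensor_elem_bilinear)
  then show ?thesis
    unfolding tensor_map_on_def by (rule tensor_lift_on_abs[OF assms(1,2) _ assms(5)])
qed

lemma tensor_map_on_image:
  assumes "csubspace V" "csubspace W" "clinear_on V f" "clinear_on W g" "t \<in> tensor_sub V W"
  shows "tensor_map_on V W f g t \<in> tensor_sub (f ` V) (g ` W)"
proof -
  obtain p where p: "Poly_Mapping.keys p \<subseteq> V \<times> W" "t = abs_tensor p"
    using assms(5) by (rule tensor_subE)
  show ?thesis
    unfolding p(2) tensor_map_on_abs[OF assms(1-4) p(1)]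
    by (rule formal_eval_in_subspace[OF subspace_tensor_sub])
      (use p(1) in \<open>auto intro!: tensor_sub_elem\<close>)
qed

text \<open>The normal form behind the injectivity of \<Phi>. A representative has finitely many
  first factors; a maximal independent subset of them spans the rest, so expanding and collecting
  terms leaves only independent first factors.\<close>

lemma tensor_independent_left:
  obtains B y where "finite B" "\<not> complex_vector.dependent B" "t = (\<Sum>b\<in>B. b \<otimes> y b)"
proof -
  obtain p where p: "t = abs_tensor p" by (metis Quotient_abs_rep Quotient_tensor)
  define S where "S = fst ` Poly_Mapping.keys p"
  obtain B where B: "B \<subseteq> S" "\<not> complex_vector.dependent B" "S \<subseteq> cspan B"
    using complex_vector.maximal_independent_subset[of S] by blast
  have fin: "finite B" using B(1) by (rule finite_subset) (simp add: S_def)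
  \<comment> \<open>\<open>U\<close> collects the tensors of the required form for this
    \<open>B\<close>. Being a subspace, it contains \<open>t\<close> once it contains every
    \<open>x \<otimes> z\<close> with \<open>x\<close> in the span of \<open>B\<close>.\<close>
  define U where "U = range (\<lambda>y. \<Sum>b\<in>B. b \<otimes> (y b :: 'b))"
  have U: "csubspace U"
  proof (rule complex_vector.subspaceI)
    show "0 \<in> U" unfolding U_def by (intro range_eqI[of _ _ "\<lambda>_. 0"]) simp
    fix s t assume "s \<in> U" "t \<in> U"
    then obtain y z where "s = (\<Sum>b\<in>B. b \<otimes> y b)" "t = (\<Sum>b\<in>B. b \<otimes> z b)"
      by (auto simp: U_def)
    then show "s + t \<in> U" unfolding U_def
      by (intro range_eqI[of _ _ "\<lambda>b. y b + z b"]) (simp add: tensor_elem_bilinear sum.distrib)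
  next
    fix c s assume "s \<in> U"
    then obtain y where "s = (\<Sum>b\<in>B. b \<otimes> y b)" by (auto simp: U_def)
    then show "c *\<^sub>C s \<in> U" unfolding U_def
      by (intro range_eqI[of _ _ "\<lambda>b. c *\<^sub>C y b"])
        (simp add: tensor_elem_bilinear complex_vector.scale_sum_right)
  qed
  have elem: "x \<otimes> z \<in> U" if "x \<in> cspan B" for x z
    using that
  proof (induction rule: complex_vector.span_induct_alt)
    case base
    show ?case using complex_vector.subspace_0[OF U] by simp
  next
    case (step c x y)
    \<comment> \<open>Padding with zero second factors gives the single term the shape of a sum over
      \<open>B\<close>.\<close>
    have "x \<otimes> z = (\<Sum>b\<in>B. b \<otimes> (if b = x then z else 0))"
      using fin step(1) by (subst sum.remove[of _ x]) (auto intro!: sum.neutral)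
    then have "x \<otimes> z \<in> U" unfolding U_def
      by (rule range_eqI[of _ _ "\<lambda>b. if b = x then z else 0"])
    then show ?case
      using step(2) complex_vector.subspace_add[OF U] complex_vector.subspace_scale[OF U]
      by (simp add: tensor_elem_bilinear)
  qed
  have "t \<in> U" unfolding p abs_tensor_eq_formal_eval
  proof (rule formal_eval_in_subspace[OF U])
    fix x y assume "(x, y) \<in> Poly_Mapping.keys p"
    then have "x \<in> S" unfolding S_def by force
    then show "x \<otimes> y \<in> U" using B(3) elem by blast
  qed
  then show thesis using that[OF fin B(2)] by (auto simp: U_def)
qed


section \<open>Polynomials in two indeterminates\<close>

lemma scaleC_eq_smult: "c *\<^sub>C p = smult c p" for p :: "complex poly"
  by (rule poly_eqI) (simp add: scaleC_poly_def coeff_map_poly scaleC_complex_def)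

lemma scaleC_eq_smult_const: "c *\<^sub>C P = smult [:c:] P" for P :: "complex poly poly"
  by (rule poly_eqI) (simp add: scaleC_poly_def[where 'a = "complex poly"] coeff_map_poly scaleC_eq_smult)

text \<open>The argument \<nu> is the value of \<lambda>, the inner indeterminate. Identities in two
  indeterminates are checked through these values, by arithmetic with complex numbers.\<close>

definition eval2 :: "complex \<Rightarrow> complex \<Rightarrow> complex poly poly \<Rightarrow> complex"
  where "eval2 \<mu> \<nu> P = poly (poly P [:\<mu>:]) \<nu>"

lemma eval2_simps [simp]:
  "eval2 \<mu> \<nu> (P + Q) = eval2 \<mu> \<nu> P + eval2 \<mu> \<nu> Q"
  "eval2 \<mu> \<nu> (P - Q) = eval2 \<mu> \<nu> P - eval2 \<mu> \<nu> Q"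
  "eval2 \<mu> \<nu> (- P) = - eval2 \<mu> \<nu> P"
  "eval2 \<mu> \<nu> (P * Q) = eval2 \<mu> \<nu> P * eval2 \<mu> \<nu> Q"
  "eval2 \<mu> \<nu> (c *\<^sub>C P) = c * eval2 \<mu> \<nu> P"
  "eval2 \<mu> \<nu> 0 = 0"
  "eval2 \<mu> \<nu> Mu = \<mu>"
  "eval2 \<mu> \<nu> Lam = \<nu>"
  by (simp_all add: eval2_def Mu_def Lam_def scaleC_eq_smult_const)

lemma eval2_eval_at [simp]: "eval2 \<mu> \<nu> (eval_at p q) = poly p (eval2 \<mu> \<nu> q)"
proof -
  have "map_poly (\<lambda>c. [:c:]) (pCons a p) = pCons [:a:] (map_poly (\<lambda>c. [:c:]) p)" for a :: complex and p
    by (rule map_poly_pCons) simp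
  then show ?thesis
    unfolding eval_at_def eval2_def
    by (induction p) (simp_all add: pcompose_pCons)
qed

lemma clinear_on_eval2: "clinear_on UNIV (eval2 \<mu> \<nu>)"
  by (simp add: clinear_on_def scaleC_complex_def)

lemma poly_ext: "(\<And>x. poly p x = poly q x) \<Longrightarrow> p = q" for p q :: "complex poly"
  by (simp add: poly_eq_poly_eq_iff[symmetric] fun_eq_iff)

text \<open>As a polynomial in \<mu> over the integral domain of polynomials in \<lambda>, a nonzero
  difference has finitely many roots, but by hypothesis every constant would be one.\<close>

lemma eval2_ext:
  assumes "\<And>\<mu> \<nu>. eval2 \<mu> \<nu> P = eval2 \<mu> \<nu> Q"
  shows "P = Q"
proof (rule ccontr)
  assume "P \<noteq> Q"
  then have "finite {x. poly (P - Q) x = 0}" by (intro poly_roots_finite) simp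
  moreover have "range (\<lambda>\<mu>. [:\<mu>:]) \<subseteq> {x. poly (P - Q) x = 0}"
    using assms by (auto simp: eval2_def intro!: poly_ext)
  ultimately have "finite (range (\<lambda>\<mu>::complex. [:\<mu>:]))" by (rule finite_subset[rotated])
  moreover have "inj (\<lambda>\<mu>::complex. [:\<mu>:])" by (auto intro: injI)
  ultimately show False using finite_imageD infinite_UNIV_char_0 by blast
qed

text \<open>The sign change that turns multiplication by \<lambda>, as in the condition defining
  \<open>conf_dual\<close>, into the action of \<open>conf_dual_del\<close> by -\<lambda>, and
  back.\<close>

definition negate :: "complex poly \<Rightarrow> complex poly"
  where "negate p = pcompose p [:0, -1:]"

lemma poly_negate [simp]: "poly (negate p) x = poly p (- x)"
  by (simp add: negate_def poly_pcompose)

lemma negate_simps [simp]: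
  "negate (p + q) = negate p + negate q"
  "negate (p * q) = negate p * negate q"
  "negate (c *\<^sub>C p) = c *\<^sub>C negate p"
  "negate (- p) = - negate p"
  "negate 0 = 0"
  "negate (pCons 0 p) = - pCons 0 (negate p)"
  "negate (negate p) = p"
  by (rule poly_ext, simp add: scaleC_eq_smult)+

lemma inj_negate: "inj negate"
  by (metis injI negate_simps(7))

lemma eval2_map_negate: "eval2 \<mu> \<nu> (map_poly negate P) = eval2 \<mu> (- \<nu>) P"
proof -
  have "map_poly negate (pCons a P) = pCons (negate a) (map_poly negate P)" for a P
    by (rule map_poly_pCons) simp
  then show ?thesis
    unfolding eval2_def by (induction P) simp_all
qed


section \<open>Injectivity of the comparison map and the largest good submodule\<close>

lemma cbilinear_on_eval_at:
  "cbilinear_on UNIV UNIV (\<lambda>f g. eval_at (f a) P * eval_at (g b) Q)"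
  by (auto simp: cbilinear_on_def clinear_on_def scaleC_fun_def scaleC_eq_smult algebra_simps
      intro!: eval2_ext)

lemma clinear_on_Phi_map: "clinear_on UNIV (\<lambda>t. Phi_map \<nu> t a b)"
  unfolding Phi_map_def by (rule clinear_on_tensor_lift[OF cbilinear_on_eval_at])

lemma Phi_map_elem:
  "Phi_map \<nu> (f \<otimes> g) a b = eval_at (f a) \<nu> * eval_at (g b) (Lam - \<nu>)"
  unfolding Phi_map_def by (subst tensor_lift_on_elem) (simp_all add: cbilinear_on_eval_at)

text \<open>With independent first factors in \<open>t\<close>, the vanishing of \<Phi> at a fixed
  \<open>b\<close> is, coefficient by coefficient in the second variable, a linear relation between
  these factors. So all coefficients of the second factors vanish.\<close>

lemma Phi_map_zero_imp_zero:
  assumes zero: "\<And>a b. Phi_map (- Mu) t a b = 0"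
  shows "t = 0"
proof -
  obtain B y where B: "finite B" "\<not> complex_vector.dependent B" "t = (\<Sum>b\<in>B. b \<otimes> y b)"
    by (rule tensor_independent_left)
  \<comment> \<open>Independent variables \<open>u = - \<mu>\<close> and \<open>v = \<lambda> + \<mu>\<close> decouple the two factors.\<close>
  have ev: "(\<Sum>f\<in>B. poly (f a) u * poly (y f b) v) = 0" for a b u v
  proof -
    have "0 = eval2 (- u) (v + u) (Phi_map (- Mu) t a b)" by (simp add: zero)
    also have "\<dots> = (\<Sum>f\<in>B. poly (f a) u * poly (y f b) v)"
      by (simp add: B(3) clinear_on_sum[OF clinear_on_Phi_map] clinear_on_sum[OF clinear_on_eval2]
          Phi_map_elem)
    finally show ?thesis by simp
  qed
  have y_zero: "y f = 0" if f: "f \<in> B" for f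
  proof (intro ext poly_eqI)
    fix b k
    \<comment> \<open>First an identity of polynomials in \<open>v\<close>; its \<open>k\<close>-th
      coefficient is then read as a polynomial in \<open>u\<close>, which leaves a relation between
      the functions in \<open>B\<close> with constants \<open>coeff (y f b) k\<close>.\<close>
    have "(\<Sum>f\<in>B. smult (poly (f a) u) (y f b)) = 0" for a u
      by (rule poly_ext) (simp add: poly_sum ev)
    then have "coeff (\<Sum>f\<in>B. smult (poly (f a) u) (y f b)) k = 0" for a u by simp
    then have "(\<Sum>f\<in>B. coeff (y f b) k *\<^sub>C f a) = 0" for a
      by (intro poly_ext) (simp add: coeff_sum poly_sum scaleC_eq_smult mult.commute)
    moreover have "(\<Sum>f\<in>B. coeff (y f b) k *\<^sub>C f) a = (\<Sum>f\<in>B. coeff (y f b) k *\<^sub>C f a)" for a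
      using B(1) by (induction B rule: finite_induct) (simp_all add: scaleC_fun_def)
    ultimately have "(\<Sum>f\<in>B. coeff (y f b) k *\<^sub>C f) = 0" by (intro ext) simp
    then show "coeff (y f b) k = coeff (0 b) k"
      using complex_vector.independentD[OF B(2) B(1) subset_refl, of "\<lambda>f. coeff (y f b) k"] f
      by simp
  qed
  show ?thesis using B(3) y_zero by simp
qed

text \<open>Elements of the conformal dual vanish off the carrier, so agreement on the carrier is
  agreement at all arguments, and the vanishing criterion applies to \<open>s - t\<close>.\<close>

lemma Phi_map_inj:
  assumes "s \<in> tensor_sub (conf_dual L) (conf_dual L)" "t \<in> tensor_sub (conf_dual L) (conf_dual L)"
    and eq: "\<And>a b. a \<in> carrier L \<Longrightarrow> b \<in> carrier L \<Longrightarrow> Phi_map (- Mu) s a b = Phi_map (- Mu) t a b"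
  shows "s = t"
proof -
  have d: "s - t \<in> tensor_sub (conf_dual L) (conf_dual L)"
    using assms(1,2) by (rule complex_vector.subspace_diff[OF subspace_tensor_sub])
  have diff: "Phi_map (- Mu) (s - t) a b = Phi_map (- Mu) s a b - Phi_map (- Mu) t a b" for a b
    using clinear_on_add[OF clinear_on_Phi_map, of "s - t" t "- Mu" a b] by simp
  have "Phi_map (- Mu) (s - t) a b = 0" for a b
  proof (cases "a \<in> carrier L \<and> b \<in> carrier L")
    case True
    then show ?thesis by (simp add: diff eq)
  next
    case False
    have [simp]: "eval_at 0 q = 0" for q by (simp add: eval_at_def)
    \<comment> \<open>Every generator \<open>f \<otimes> g\<close> has \<open>f a = 0\<close> or
      \<open>g b = 0\<close> here, so \<Phi> vanishes on the whole span.\<close>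
    show ?thesis
      using d unfolding tensor_sub_def
    proof (induction rule: complex_vector.span_induct_alt)
      case base
      show ?case by (simp add: clinear_on_zero[OF clinear_on_Phi_map])
    next
      case (step c r u)
      then obtain f g where "r = f \<otimes> g" "f \<in> conf_dual L" "g \<in> conf_dual L" by blast
      then have "Phi_map (- Mu) r a b = 0"
        using False by (auto simp: Phi_map_elem conf_dual_def)
      then show ?case
        using step(2)
        by (simp add: clinear_on_add[OF clinear_on_Phi_map] clinear_on_scale[OF clinear_on_Phi_map])
    qed
  qed
  then have "s - t = 0" by (rule Phi_map_zero_imp_zero)
  then show ?thesis by simp
qed

section \<open>The largest good submodule and its cobracket\<close>

lemma lie_conformal_algebraD:
  assumes "lie_conformal_algebra L"
  shows "is_cdmod L"
    and "a \<in> carrier L \<Longrightarrow> b \<in> carrier L \<Longrightarrow> bracket L a b n \<in> carrier L"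
    and "a \<in> carrier L \<Longrightarrow> b \<in> carrier L \<Longrightarrow> finite {n. bracket L a b n \<noteq> 0}"
  using assms unfolding lie_conformal_algebra_def by blast+

lemma differential_lie_coalgebraD:
  assumes "differential_lie_coalgebra M"
  shows "is_cdmod M"
    and "r \<in> carrier M \<Longrightarrow> cobracket M r \<in> tensor_sub (carrier M) (carrier M)"
  using assms unfolding differential_lie_coalgebra_def Let_def by blast+

text \<open>\<open>pi_map\<close> omits the terms with zero bracket; \<open>f 0 = 0\<close> makes
  the formula right for those \<open>n\<close> too.\<close>

lemma coeff_pi_map:
  assumes "lie_conformal_algebra L" "f 0 = 0" "a \<in> carrier L" "b \<in> carrier L"
  shows "coeff (pi_map L f a b) n = f (bracket L a b n)"
proof -
  have "finite {n. bracket L a b n \<noteq> 0}"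
    using assms lie_conformal_algebraD(3) by blast
  then show ?thesis
    by (auto simp: pi_map_def coeff_sum assms(2))
qed

lemma subspace_conf_dual: "csubspace (conf_dual U)"
proof (rule complex_vector.subspaceI)
  show "0 \<in> conf_dual U" by (simp add: conf_dual_def clinear_on_def)
next
  fix f g assume "f \<in> conf_dual U" "g \<in> conf_dual U"
  then show "f + g \<in> conf_dual U"
    by (simp add: conf_dual_def clinear_on_def scaleC_add_right ac_simps)
next
  fix c f assume "f \<in> conf_dual U"
  then show "c *\<^sub>C f \<in> conf_dual U"
    by (simp add: conf_dual_def clinear_on_def scaleC_fun_def scaleC_eq_smult smult_add_right
        mult.commute)
qed

lemma conf_dual_zero:
  assumes "f \<in> conf_dual L" "is_cdmod L"
  shows "f 0 = 0"
proof (rule clinear_on_zero)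
  show "clinear_on (carrier L) f" using assms(1) by (simp add: conf_dual_def)
  show "csubspace (carrier L)" using assms(2) by (simp add: is_cdmod_def)
qed

lemma good_imp_good_sum: "good L V \<Longrightarrow> V \<subseteq> good_sum L"
  unfolding good_sum_def by (rule order_trans[OF _ complex_vector.span_superset]) blast

lemma good_sum_subset: "good_sum L \<subseteq> conf_dual L"
  unfolding good_sum_def
proof (rule complex_vector.span_minimal[OF _ subspace_conf_dual])
  show "\<Union> {V. good L V} \<subseteq> conf_dual L" by (rule Union_least) (simp add: good_def)
qed

text \<open>The defining identity of a cobracket is linear in \<open>f\<close> and \<open>t\<close>
  together, so witnesses from different good submodules can be combined once they are moved into the
  tensor square of the sum.\<close>

lemma good_good_sum:
  assumes L: "lie_conformal_algebra L"
  shows "good L (good_sum L)"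
proof -
  note mod = lie_conformal_algebraD(1)[OF L]
  have sub: "csubspace (good_sum L)"
    unfolding good_sum_def by (rule complex_vector.subspace_span)
  have "conf_dual_del f \<in> good_sum L \<and> (\<exists>t. is_cobracket_of L (good_sum L) f t)"
    if "f \<in> good_sum L" for f
  proof -
    \<comment> \<open>Membership is carried through the induction: it gives \<open>g 0 = 0\<close>
      for the part already summed, as \<open>coeff_pi_map\<close> requires.\<close>
    have "f \<in> good_sum L \<and> conf_dual_del f \<in> good_sum L \<and> (\<exists>t. is_cobracket_of L (good_sum L) f t)"
      using that[unfolded good_sum_def]
    proof (induction rule: complex_vector.span_induct_alt)
      case base
      have "conf_dual_del 0 = 0" by (simp add: conf_dual_del_def fun_eq_iff)
      moreover have "is_cobracket_of L (good_sum L) 0 0"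
        by (simp add: is_cobracket_of_def complex_vector.subspace_0[OF subspace_tensor_sub]
            clinear_on_zero[OF clinear_on_Phi_map] pi_map_def)
      ultimately show ?case using complex_vector.subspace_0[OF sub] by metis
    next
      case (step c f g)
      then obtain V s t where V: "good L V" "f \<in> V" and s: "is_cobracket_of L V f s"
        and g: "g \<in> good_sum L" "conf_dual_del g \<in> good_sum L"
        and t: "is_cobracket_of L (good_sum L) g t"
        unfolding good_def by blast
      note incl = good_imp_good_sum[OF V(1)]
      have f: "f \<in> good_sum L" "conf_dual_del f \<in> good_sum L"
        using V incl by (auto simp: good_def)
      note lin = complex_vector.subspace_add[OF sub complex_vector.subspace_scale[OF sub]]
      have "conf_dual_del (c *\<^sub>C f + g) = c *\<^sub>C conf_dual_del f + conf_dual_del g"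
        by (simp add: conf_dual_del_def fun_eq_iff scaleC_fun_def scaleC_eq_smult algebra_simps)
      moreover have "is_cobracket_of L (good_sum L) (c *\<^sub>C f + g) (c *\<^sub>C s + t)"
        unfolding is_cobracket_of_def
      proof (intro conjI ballI)
        have "s \<in> tensor_sub (good_sum L) (good_sum L)"
          using s tensor_sub_mono[OF incl incl] by (auto simp: is_cobracket_of_def)
        then show "c *\<^sub>C s + t \<in> tensor_sub (good_sum L) (good_sum L)"
          using t by (auto simp: is_cobracket_of_def intro!: complex_vector.subspace_add
              complex_vector.subspace_scale subspace_tensor_sub)
        fix a b assume ab: "a \<in> carrier L" "b \<in> carrier L"
        have z: "f 0 = 0" "g 0 = 0"
          using f(1) g(1) good_sum_subset conf_dual_zero[OF _ mod] by blast+
        have "pi_map L (c *\<^sub>C f + g) a b = c *\<^sub>C pi_map L f a b + pi_map L g a b"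
          by (rule poly_eqI)
            (use ab z in \<open>simp add: scaleC_eq_smult_const coeff_pi_map[OF L] scaleC_fun_def scaleC_eq_smult\<close>)
        then show "Phi_map (- Mu) (c *\<^sub>C s + t) a b = pi_map L (c *\<^sub>C f + g) a b"
          using s t ab
          by (simp add: is_cobracket_of_def clinear_on_add[OF clinear_on_Phi_map]
              clinear_on_scale[OF clinear_on_Phi_map])
      qed
      ultimately show ?case using f g lin by metis
    qed
    then show ?thesis by simp
  qed
  then show ?thesis
    using good_sum_subset sub by (simp add: good_def)
qed

lemma is_cobracket_of_unique:
  assumes "V \<subseteq> conf_dual L" "is_cobracket_of L V f s" "is_cobracket_of L V f t"
  shows "s = t"
proof (rule Phi_map_inj)
  show "s \<in> tensor_sub (conf_dual L) (conf_dual L)" "t \<in> tensor_sub (conf_dual L) (conf_dual L)"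
    using assms tensor_sub_mono[OF assms(1,1)] by (auto simp: is_cobracket_of_def)
qed (use assms in \<open>auto simp: is_cobracket_of_def\<close>)

text \<open>Existence comes from goodness of \<open>good_sum L\<close>, uniqueness from injectivity
  of \<Phi>; together they make the \<open>THE\<close> in \<open>zero_dlc\<close>
  meaningful.\<close>

lemma cobracket_zero_dlc_eq_iff:
  assumes "lie_conformal_algebra L" "f \<in> good_sum L"
  shows "cobracket (zero_dlc L) f = t \<longleftrightarrow> is_cobracket_of L (good_sum L) f t"
proof -
  obtain s where s: "is_cobracket_of L (good_sum L) f s"
    using good_good_sum[OF assms(1)] assms(2) by (auto simp: good_def)
  then have "cobracket (zero_dlc L) f = s"
    unfolding zero_dlc_def
    using is_cobracket_of_unique[OF good_sum_subset] by simp (rule the_equality; blast)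
  then show ?thesis using s is_cobracket_of_unique[OF good_sum_subset s] by metis
qed


section \<open>The adjunction\<close>

definition dual_flip :: "('a \<Rightarrow> 'b \<Rightarrow> complex poly) \<Rightarrow> 'b \<Rightarrow> 'a \<Rightarrow> complex poly"
  where "dual_flip \<phi> = (\<lambda>m a. negate (\<phi> a m))"

lemma dual_flip_dual_flip [simp]: "dual_flip (dual_flip \<phi>) = \<phi>"
  by (simp add: dual_flip_def)

text \<open>The part of a homomorphism that does not involve brackets. Only carriers and derivations
  enter, so the same notion serves both directions of the adjunction.\<close>

definition dual_hom :: "('a::complex_vector, 'x) cdmod_scheme \<Rightarrow>
    ('b::complex_vector, 'y) cdmod_scheme \<Rightarrow> ('a \<Rightarrow> 'b \<Rightarrow> complex poly) set"
  where "dual_hom L M = cdmod_hom L \<lparr>carrier = conf_dual M, del = conf_dual_del\<rparr>"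

text \<open>The two compatibilities with \<partial> trade places. After the sign change,
  \<phi>(\<partial>a) = -\<lambda>\<phi>(a) says that the values of the flip lie in
  \<open>conf_dual L\<close>, and \<phi>(a)(\<partial>m) = \<lambda>\<phi>(a)(m) says that the flip
  commutes with \<partial>.\<close>

lemma dual_homI_flip:
  assumes "is_cdmod L" "\<phi> \<in> dual_hom L M"
  shows "dual_flip \<phi> \<in> dual_hom M L"
proof -
  \<comment> \<open>Also for \<open>a\<close> outside the carrier, because equations between values
    of the flip are equations between functions on the whole type.\<close>
  have dual: "\<phi> a \<in> conf_dual M" for a
  proof (cases "a \<in> carrier L")
    case False
    then have "\<phi> a = 0" using assms by (auto simp: dual_hom_def cdmod_hom_def)
    then show ?thesis using complex_vector.subspace_0[OF subspace_conf_dual] by simp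
  qed (use assms in \<open>auto simp: dual_hom_def cdmod_hom_def\<close>)
  have \<phi>: "clinear_on (carrier L) \<phi>" "\<And>a. a \<notin> carrier L \<Longrightarrow> \<phi> a = 0"
    "\<And>a. a \<in> carrier L \<Longrightarrow> \<phi> (del L a) = conf_dual_del (\<phi> a)"
    using assms(2) by (auto simp: dual_hom_def cdmod_hom_def)
  have lin: "clinear_on (carrier M) (\<phi> a)"
    and del: "m \<in> carrier M \<Longrightarrow> \<phi> a (del M m) = [:0, 1:] * \<phi> a m"
    and out: "m \<notin> carrier M \<Longrightarrow> \<phi> a m = 0" for a m
    using dual[of a] by (auto simp: conf_dual_def)
  have "dual_flip \<phi> m \<in> conf_dual L" for m
    using \<phi> unfolding conf_dual_def dual_flip_def clinear_on_def
    by (auto simp: scaleC_fun_def conf_dual_del_def)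
  moreover have "clinear_on (carrier M) (dual_flip \<phi>)"
    using lin by (auto simp: dual_flip_def clinear_on_def scaleC_fun_def fun_eq_iff)
  ultimately show ?thesis
    using del out
    by (auto simp: dual_hom_def cdmod_hom_def dual_flip_def conf_dual_del_def fun_eq_iff)
qed

section \<open>Brackets compared with cobrackets\<close>

lemma lca_hom_dual_iff:
  "\<phi> \<in> lca_hom L (dual_lca M) \<longleftrightarrow> \<phi> \<in> dual_hom L M \<and>
    (\<forall>a\<in>carrier L. \<forall>b\<in>carrier L. \<forall>n. \<phi> (bracket L a b n)
      = restrict_zero (carrier M) (\<lambda>r. coeff (dual_bracket_poly M (\<phi> a) (\<phi> b) r) n))"
  unfolding lca_hom_def dual_hom_def cdmod_hom_def dual_lca_def by simp

lemma dual_hom_mem: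
  assumes "\<phi> \<in> dual_hom L M"
  shows "a \<in> carrier L \<Longrightarrow> \<phi> a \<in> conf_dual M" "clinear_on (carrier L) \<phi>"
    "a \<notin> carrier L \<Longrightarrow> \<phi> a = 0"
  using assms by (auto simp: dual_hom_def cdmod_hom_def)

text \<open>On \<open>x \<otimes> y\<close> the left side is \<open>\<phi> a x\<close> at \<mu>
  times \<open>\<phi> b y\<close> at -\<lambda> - \<mu>: the parameter -\<mu> cancels the sign of
  the flip in the first factor, and the second is that of the bracket with -\<lambda> in place of
  \<lambda>.\<close>

lemma Phi_map_dual_flip:
  assumes M: "is_cdmod M" and \<psi>: "dual_flip \<phi> \<in> dual_hom M L" and \<phi>: "\<phi> \<in> dual_hom L M"
    and r: "cobracket M r \<in> tensor_sub (carrier M) (carrier M)"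
    and ab: "a \<in> carrier L" "b \<in> carrier L"
  shows "Phi_map (- Mu)
      (tensor_map_on (carrier M) (carrier M) (dual_flip \<phi>) (dual_flip \<phi>) (cobracket M r)) a b
    = map_poly negate (dual_bracket_poly M (\<phi> a) (\<phi> b) r)"
proof (rule eval2_ext)
  fix \<mu> \<nu>
  let ?V = "carrier M" and ?\<psi> = "dual_flip \<phi>"
  have V: "csubspace ?V" using M by (simp add: is_cdmod_def)
  obtain p where p: "Poly_Mapping.keys p \<subseteq> ?V \<times> ?V" "cobracket M r = abs_tensor p"
    using r by (rule tensor_subE)
  have "clinear_on ?V (\<phi> a)" "clinear_on ?V (\<phi> b)"
    using dual_hom_mem(1)[OF \<phi>] ab by (auto simp: conf_dual_def)
  then have bil: "cbilinear_on ?V ?V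
      (\<lambda>x y. eval_at (\<phi> a x) Mu * eval_at (\<phi> b y) (Lam - Mu))"
    by (auto simp: cbilinear_on_def clinear_on_def scaleC_eq_smult algebra_simps intro!: eval2_ext)
  note lin = dual_hom_mem(2)[OF \<psi>]
  \<comment> \<open>One representative \<open>p\<close> with keys in the carrier of \<open>M\<close>
    turns both sides into the same formal sum.\<close>
  have "eval2 \<mu> \<nu> (Phi_map (- Mu) (tensor_map_on ?V ?V ?\<psi> ?\<psi> (cobracket M r)) a b)
      = formal_eval (\<lambda>x y. poly (\<phi> a x) \<mu> * poly (\<phi> b y) (- \<nu> - \<mu>)) p"
    by (simp add: p(2) tensor_map_on_abs[OF V V lin lin p(1)]
        clinear_on_formal_eval[OF clinear_on_Phi_map] clinear_on_formal_eval[OF clinear_on_eval2]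
        Phi_map_elem) (simp add: dual_flip_def)
  also have "\<dots> = eval2 \<mu> \<nu> (map_poly negate (dual_bracket_poly M (\<phi> a) (\<phi> b) r))"
    by (simp add: eval2_map_negate dual_bracket_poly_def p(2) tensor_lift_on_abs[OF V V bil p(1)]
        clinear_on_formal_eval[OF clinear_on_eval2])
  finally show "eval2 \<mu> \<nu>
      (Phi_map (- Mu) (tensor_map_on ?V ?V ?\<psi> ?\<psi> (cobracket M r)) a b) = \<dots>" .
qed

text \<open>Compare coefficients of powers of \<mu> at each \<open>r\<close>. By
  \<open>Phi_map_dual_flip\<close> both sides then carry \<open>negate\<close>, which is injective
  and cancels.\<close>

lemma bracket_hom_iff:
  assumes L: "lie_conformal_algebra L" and M: "differential_lie_coalgebra M"
    and \<phi>: "\<phi> \<in> dual_hom L M" and ab: "a \<in> carrier L" "b \<in> carrier L"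
  shows "(\<forall>n. \<phi> (bracket L a b n)
      = restrict_zero (carrier M) (\<lambda>r. coeff (dual_bracket_poly M (\<phi> a) (\<phi> b) r) n)) \<longleftrightarrow>
    (\<forall>r\<in>carrier M. Phi_map (- Mu)
      (tensor_map_on (carrier M) (carrier M) (dual_flip \<phi>) (dual_flip \<phi>) (cobracket M r)) a b
        = pi_map L (dual_flip \<phi> r) a b)"
proof -
  note modL = lie_conformal_algebraD(1)[OF L]
  note closed = lie_conformal_algebraD(2)[OF L ab]
  note modM = differential_lie_coalgebraD(1)[OF M]
  note \<delta> = differential_lie_coalgebraD(2)[OF M]
  note \<psi> = dual_homI_flip[OF modL \<phi>]
  \<comment> \<open>Equality of functions also concerns \<open>r\<close> outside the carrier; there
    \<open>restrict_zero\<close> gives zero, and so does the left side.\<close>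
  have out: "\<phi> (bracket L a b n) r = 0" if "r \<notin> carrier M" for n r
    using dual_hom_mem(1)[OF \<phi> closed] that by (simp add: conf_dual_def)
  have "Phi_map (- Mu)
      (tensor_map_on (carrier M) (carrier M) (dual_flip \<phi>) (dual_flip \<phi>) (cobracket M r)) a b
        = pi_map L (dual_flip \<phi> r) a b \<longleftrightarrow>
      (\<forall>n. \<phi> (bracket L a b n) r = coeff (dual_bracket_poly M (\<phi> a) (\<phi> b) r) n)"
    if r: "r \<in> carrier M" for r
  proof -
    have z: "dual_flip \<phi> r 0 = 0"
      using dual_hom_mem(1)[OF \<psi> r] modL by (rule conf_dual_zero)
    show ?thesis
      unfolding Phi_map_dual_flip[OF modM \<psi> \<phi> \<delta>[OF r] ab]
      by (subst poly_eq_iff, simp add: coeff_map_poly coeff_pi_map[of L "dual_flip \<phi> r", OF L z ab])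
        (auto simp: dual_flip_def inj_eq[OF inj_negate])
  qed
  then show ?thesis
    using out by (auto simp: restrict_zero_def fun_eq_iff)
qed

text \<open>The tensor pushed forward from \<open>cobracket M r\<close> lies in the tensor square of
  the image of the flip, so it witnesses that this image is good.\<close>

lemma dual_flip_dlc_hom:
  assumes L: "lie_conformal_algebra L" and M: "differential_lie_coalgebra M"
    and \<phi>: "\<phi> \<in> lca_hom L (dual_lca M)"
  shows "dual_flip \<phi> \<in> dlc_hom M (zero_dlc L)"
proof -
  let ?V = "carrier M" and ?\<psi> = "dual_flip \<phi>"
  let ?t = "\<lambda>r. tensor_map_on ?V ?V ?\<psi> ?\<psi> (cobracket M r)"
  note modL = lie_conformal_algebraD(1)[OF L]
  note modM = differential_lie_coalgebraD(1)[OF M]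
  note \<delta> = differential_lie_coalgebraD(2)[OF M]
  have V: "csubspace ?V" "\<And>m. m \<in> ?V \<Longrightarrow> del M m \<in> ?V"
    using modM by (simp_all add: is_cdmod_def)
  have dual: "\<phi> \<in> dual_hom L M" using \<phi> by (simp add: lca_hom_dual_iff)
  note \<psi> = dual_homI_flip[OF modL dual]
  have Phi: "Phi_map (- Mu) (?t r) a b = pi_map L (?\<psi> r) a b"
    if "r \<in> ?V" "a \<in> carrier L" "b \<in> carrier L" for r a b
    using \<phi> that bracket_hom_iff[OF L M dual that(2,3)] by (simp add: lca_hom_dual_iff)
  note lin = dual_hom_mem(2)[OF \<psi>]
  have cob: "is_cobracket_of L (?\<psi> ` ?V) (?\<psi> r) (?t r)" if "r \<in> ?V" for r
    unfolding is_cobracket_of_def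
    using tensor_map_on_image[OF V(1) V(1) lin lin \<delta>[OF that]] Phi[OF that] by simp
  have "good L (?\<psi> ` ?V)"
    unfolding good_def
  proof (intro conjI ballI)
    show "?\<psi> ` ?V \<subseteq> conf_dual L" using dual_hom_mem(1)[OF \<psi>] by blast
    show "csubspace (?\<psi> ` ?V)"
    proof (rule complex_vector.subspaceI)
      show "0 \<in> ?\<psi> ` ?V"
        using clinear_on_zero[OF lin V(1)] complex_vector.subspace_0[OF V(1)] by force
    next
      fix f g assume "f \<in> ?\<psi> ` ?V" "g \<in> ?\<psi> ` ?V"
      then show "f + g \<in> ?\<psi> ` ?V"
        using complex_vector.subspace_add[OF V(1)]
        by (auto simp: clinear_on_add[OF lin, symmetric])
    next
      fix c f assume "f \<in> ?\<psi> ` ?V"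
      then show "c *\<^sub>C f \<in> ?\<psi> ` ?V"
        using complex_vector.subspace_scale[OF V(1)]
        by (auto simp: clinear_on_scale[OF lin, symmetric])
    qed
  next
    fix f assume f: "f \<in> ?\<psi> ` ?V"
    then obtain r where r: "r \<in> ?V" "f = ?\<psi> r" by blast
    have "conf_dual_del f = ?\<psi> (del M r)"
      using \<psi> r by (simp add: dual_hom_def cdmod_hom_def)
    then show "conf_dual_del f \<in> ?\<psi> ` ?V" using V(2)[OF r(1)] by blast
    show "\<exists>t. is_cobracket_of L (?\<psi> ` ?V) f t" using cob[OF r(1)] r(2) by blast
  qed
  then have incl: "?\<psi> ` ?V \<subseteq> good_sum L" by (rule good_imp_good_sum)
  have "?\<psi> \<in> cdmod_hom M (zero_dlc L)"
    using \<psi> incl by (auto simp: dual_hom_def cdmod_hom_def zero_dlc_def)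
  moreover have "cobracket (zero_dlc L) (?\<psi> r) = ?t r" if "r \<in> ?V" for r
  proof -
    \<comment> \<open>The witness for the image remains one in the larger module, and uniqueness
      identifies it with the cobracket of \<open>zero_dlc L\<close>.\<close>
    have "is_cobracket_of L (good_sum L) (?\<psi> r) (?t r)"
      using cob[OF that] tensor_sub_mono[OF incl incl] by (auto simp: is_cobracket_of_def)
    then show ?thesis using cobracket_zero_dlc_eq_iff[OF L] incl that by blast
  qed
  ultimately show ?thesis by (simp add: dlc_hom_def)
qed

text \<open>A homomorphism sends \<open>cobracket M r\<close> to the cobracket of
  \<open>\<psi> r\<close>, which satisfies its defining identity; \<open>bracket_hom_iff\<close> for
  \<open>dual_flip \<psi>\<close>, whose flip is \<psi>, translates this into preservation of
  brackets.\<close>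

lemma dual_flip_lca_hom:
  assumes L: "lie_conformal_algebra L" and M: "differential_lie_coalgebra M"
    and \<psi>: "\<psi> \<in> dlc_hom M (zero_dlc L)"
  shows "dual_flip \<psi> \<in> lca_hom L (dual_lca M)"
proof -
  note modM = differential_lie_coalgebraD(1)[OF M]
  have mem: "\<psi> r \<in> good_sum L" if "r \<in> carrier M" for r
    using \<psi> that by (auto simp: dlc_hom_def cdmod_hom_def zero_dlc_def)
  then have "\<psi> \<in> dual_hom M L"
    using \<psi> good_sum_subset[of L]
    by (auto simp: dlc_hom_def dual_hom_def cdmod_hom_def zero_dlc_def)
  then have dual: "dual_flip \<psi> \<in> dual_hom L M" by (rule dual_homI_flip[OF modM])
  have "is_cobracket_of L (good_sum L) (\<psi> r)
      (tensor_map_on (carrier M) (carrier M) \<psi> \<psi> (cobracket M r))" if "r \<in> carrier M" for r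
    using cobracket_zero_dlc_eq_iff[OF L mem[OF that], THEN iffD1] \<psi> that by (simp add: dlc_hom_def)
  then have "Phi_map (- Mu) (tensor_map_on (carrier M) (carrier M) \<psi> \<psi> (cobracket M r)) a b
      = pi_map L (\<psi> r) a b" if "r \<in> carrier M" "a \<in> carrier L" "b \<in> carrier L" for r a b
    using that by (simp add: is_cobracket_of_def)
  then show ?thesis
    using dual bracket_hom_iff[OF L M dual] by (simp add: lca_hom_dual_iff)
qed

text \<open>At \<open>m\<close> and \<open>a\<close> both sides are
  \<open>negate (\<phi> (F a) (T m))\<close>, provided that \<open>restrict_zero\<close> truncates
  nothing.\<close>

lemma dual_flip_natural:
  assumes L: "lie_conformal_algebra L" and M: "differential_lie_coalgebra M"
    and F: "F \<in> lca_hom L' L" and T: "T \<in> dlc_hom M' M" and \<phi>: "\<phi> \<in> lca_hom L (dual_lca M)"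
  shows "dual_flip (dual_lca_map M' M T \<circ> \<phi> \<circ> F) = zero_dlc_map L' L F \<circ> dual_flip \<phi> \<circ> T"
proof -
  \<comment> \<open>Homomorphisms vanish outside their carriers, so with these memberships
    \<open>F a\<close> and \<open>T m\<close> lie in the carriers for all arguments.\<close>
  have 0: "0 \<in> carrier L" "0 \<in> carrier M"
    using lie_conformal_algebraD(1)[OF L] differential_lie_coalgebraD(1)[OF M]
    by (auto simp: is_cdmod_def intro: complex_vector.subspace_0)
  have "F a \<in> carrier L" for a
    using F 0 by (cases "a \<in> carrier L'") (auto simp: lca_hom_def cdmod_hom_def)
  then have "\<phi> (F a) \<in> carrier (dual_lca M)" for a
    using \<phi> by (auto simp: lca_hom_def cdmod_hom_def)
  moreover have "T m \<in> carrier M" for m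
    using T 0 by (cases "m \<in> carrier M'") (auto simp: dlc_hom_def cdmod_hom_def)
  then have "dual_flip \<phi> (T m) \<in> carrier (zero_dlc L)" for m
    using dual_flip_dlc_hom[OF L M \<phi>] by (auto simp: dlc_hom_def cdmod_hom_def)
  ultimately show ?thesis
    by (simp add: fun_eq_iff dual_lca_map_def zero_dlc_map_def restrict_zero_def transpose_def)
      (simp add: dual_flip_def dual_lca_map_def restrict_zero_def transpose_def)
qed

theorem theorem3p4:
  shows "\<exists>\<Theta> :: 'l::complex_vector lca \<Rightarrow> 'm::complex_vector dlc \<Rightarrow>
      ('l \<Rightarrow> 'm \<Rightarrow> complex poly) \<Rightarrow> ('m \<Rightarrow> 'l \<Rightarrow> complex poly).
    (\<forall>L \<in> LCA_free. \<forall>M \<in> DLC_free.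
      bij_betw (\<Theta> L M) (lca_hom L (dual_lca M)) (dlc_hom M (zero_dlc L))) \<and>
    (\<forall>L \<in> LCA_free. \<forall>L' \<in> LCA_free. \<forall>M \<in> DLC_free. \<forall>M' \<in> DLC_free.
      \<forall>F \<in> lca_hom L' L. \<forall>T \<in> dlc_hom M' M. \<forall>\<phi> \<in> lca_hom L (dual_lca M).
        \<Theta> L' M' (dual_lca_map M' M T \<circ> \<phi> \<circ> F) = zero_dlc_map L' L F \<circ> \<Theta> L M \<phi> \<circ> T)"
proof (intro exI[of _ "\<lambda>_ _. dual_flip"] conjI ballI)
  fix L :: "'l lca" and M :: "'m dlc" assume "L \<in> LCA_free" "M \<in> DLC_free"
  then have "lie_conformal_algebra L" "differential_lie_coalgebra M"
    by (simp_all add: LCA_free_def DLC_free_def)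
  \<comment> \<open>As an involution, \<open>dual_flip\<close> is its own inverse; it remains that
    it maps each set of homomorphisms into the other.\<close>
  then show "bij_betw dual_flip (lca_hom L (dual_lca M)) (dlc_hom M (zero_dlc L))"
    by (intro bij_betw_byWitness[where f' = dual_flip])
      (auto intro: dual_flip_dlc_hom dual_flip_lca_hom)
next
  fix L L' :: "'l lca" and M M' :: "'m dlc" and F T \<phi>
  assume "L \<in> LCA_free" "M \<in> DLC_free" "F \<in> lca_hom L' L" "T \<in> dlc_hom M' M"
    "\<phi> \<in> lca_hom L (dual_lca M)"
  then show "dual_flip (dual_lca_map M' M T \<circ> \<phi> \<circ> F) = zero_dlc_map L' L F \<circ> dual_flip \<phi> \<circ> T"
    unfolding LCA_free_def DLC_free_def by (blast intro: dual_flip_natural)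
qed

end
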